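(* Let $n\ge -1$, $m_1\ge 1$, $0\le k_1\le m_1-1$, $m_2\ge 1$, $0\le k_2\le m_2-1$ be integers, and put $N=m_1+n+m_2$. Let $\mathbf a=(a_1,\dots,a_{N-1})$ be the area sequence of the two-headed melting lollipop graph ${}^{(k_1)}_{m_1}L^{(k_2)}_{m_2,n}$ on $N$ vertices. Let $\mathbf b$ denote the modified sequence of length $N-1$ $$\mathbf b=(1,2,\dots,m_1-2,\;m_1-k_1-1,\;a_{m_1},a_{m_1+1},\dots,a_{N-1}),$$ that is, $b_i=i$ for $1\le i\le m_1-2$, $b_{m_1-1}=m_1-k_1-1$ if $m_1\ge 2$, and $b_i=a_i$ for $m_1\le i\le N-1$ (when $m_1=1$, $\mathbf b=\mathbf a$). Then $$\mathrm{LLT}_{\mathbf a}(\mathbf x;q)=\sum_{\alpha\vDash N}q^{\mathbf b(\mathrm{set}(\alpha))}\,r_\alpha .$$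
   Context: Notation: $[n]=\{1,\dots,n\}$; $\mathbb N$ is the set of positive integers and $\mathbf x=(x_1,x_2,\dots)$ are commuting variables; $q$ is an indeterminate. Compositions: a composition $\alpha=\alpha_1\cdots\alpha_\ell$ of $n$ (written $\alpha\vDash n$) is an ordered list of positive integers with sum $n$; $\mathrm{set}(\alpha)=\{\alpha_1,\alpha_1+\alpha_2,\dots,\alpha_1+\dots+\alpha_{\ell-1}\}\subseteq[n-1]$. For a list of integers $\mathbf v=(v_1,\dots,v_{n})$ and $S\subseteq[n]$, $\mathbf v(S)=\sum_{s\in S}v_s$. Ribbon Schur functions: for $\alpha\vDash n$, $r_\alpha=\sum_\kappa x_{\kappa(1)}\cdots x_{\kappa(n)}$, the sum over all maps $\kappa:[n]\to\mathbb N$ such that for each $i\in[n-1]$, $\kappa(i)<\kappa(i+1)$ if $i\in\mathrm{set}(\alpha)$ and $\kappa(i)\ge\kappa(i+1)$ if $i\notin\mathrm{set}(\alpha)$. Graphs: edges are written $(i,j)$ with $i<j$. A unit interval graph $G$ on $n$ vertices is a graph with vertex set $[n]$ such that if $(i,j)\in E(G)$ and $i\le k<l\le j$ then $(k,l)\in E(G)$. Its area sequence is $\mathbf a=(a_1,\dots,a_{n-1})$ with $a_i=\max(\{0\}\cup\{j-i:(i,j)\in E(G)\})$. The area sequence determines $G$. The unicellular LLT polynomial of $\mathbf a$ (or of $G$) is $$\mathrm{LLT}_{\mathbf a}(\mathbf x;q)=\sum_{\kappa:[n]\to\mathbb N}q^{\mathrm{asc}(\kappa)}x_{\kappa(1)}\cdots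 x_{\kappa(n)},$$ where $\mathrm{asc}(\kappa)$ is the number of $(i,j)\in E(G)$ with $i<j$ and $\kappa(i)<\kappa(j)$. $K_n$ is the complete graph on $[n]$; the path $P_n$ has vertex set $[n]$ and edges $(i,i+1)$, $1\le i\le n-1$. The reverse $G^r$ of a unit interval graph $G$ on $n$ vertices has vertex set $[n]$ and edge set $\{(n+1-j,n+1-i):(i,j)\in E(G)\}$. The concatenation $G+H$ of unit interval graphs $G$ and $H$ on $n$ and $m$ vertices is the unit interval graph on $[n+m-1]$ with edge set $E(G)\cup\{(i+n-1,j+n-1):(i,j)\in E(H)\}$. For $m\ge1$ and $0\le k\le m-1$, the melting complete graph $K_m^{(k)}$ is the unit interval graph on $m$ vertices obtained from $K_m$ by removing the $k$ edges $(1,m),(1,m-1),\dots,(1,m-k+1)$. For $n\ge-1$, $m_1\ge1$, $0\le k_1\le m_1-1$, $m_2\ge1$, $0\le k_2\le m_2-1$, the two-headed melting lollipop graph ${}^{(k_1)}_{m_1}L^{(k_2)}_{m_2,n}$ is the unit interval graph on $m_1+n+m_2$ vertices given by the concatenation $(K_{m_1}^{(k_1)})^r+P_{n+2}+K_{m_2}^{(k_2)}$. *)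

theory Defs
  imports
    "HOL-Computational_Algebra.Polynomial"
    "HOL-Library.Multiset"
    "HOL-Library.FuncSet"
    "HOL-Library.Function_Algebras"
begin

section \<open>Formal power series in infinitely many variables\<close>

text \<open>
  The monomial x_1^(e_1) x_2^(e_2) ... is the multiset containing each i exactly e_i times, a
  formal power series is its coefficient function, and coefficients are polynomials in the
  indeterminate q, so that q^k is \<^term>\<open>monom 1 k :: int poly\<close>. Addition and finite sums of series
  are the pointwise ones of \<^theory>\<open>HOL-Library.Function_Algebras\<close>; the pointwise product
  of that theory is \<^emph>\<open>not\<close> the product of power series and is not used.
\<close>

type_synonym series = "nat multiset \<Rightarrow> int poly"

definition monomial_series :: "nat multiset \<Rightarrow> series" where
  "monomial_series A = (\<lambda>M. if M = A then 1 else 0)"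

definition scale_series :: "int poly \<Rightarrow> series \<Rightarrow> series" where
  "scale_series c f = (\<lambda>M. c * f M)"

text \<open>
  A possibly infinite sum of series, computed coefficient by coefficient. It is meaningful when,
  for each monomial, only finitely many summands have a nonzero coefficient; see
  \<open>finite_coloring_support\<close> below.
\<close>

definition formal_sum :: "'k set \<Rightarrow> ('k \<Rightarrow> series) \<Rightarrow> series" where
  "formal_sum K f = (\<lambda>M. \<Sum>\<kappa>\<in>{\<kappa> \<in> K. f \<kappa> M \<noteq> 0}. f \<kappa> M)"

text \<open>Maps from [n] to the positive integers, made unique by extensionality outside [n].\<close>

definition colorings :: "nat \<Rightarrow> (nat \<Rightarrow> nat) set" where
  "colorings n = ({1..n} \<rightarrow>\<^sub>E {1..})"

definition coloring_monomial :: "nat \<Rightarrow> (nat \<Rightarrow> nat) \<Rightarrow> series" where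
  "coloring_monomial n \<kappa> = monomial_series (image_mset \<kappa> (mset_set {1..n}))"


section \<open>Compositions and ribbon Schur functions\<close>

definition compositions :: "nat \<Rightarrow> nat list set" where
  "compositions n = {\<alpha>. (\<forall>p\<in>set \<alpha>. 1 \<le> p) \<and> sum_list \<alpha> = n}"

definition comp_set :: "nat list \<Rightarrow> nat set" where
  "comp_set \<alpha> = {sum_list (take k \<alpha>) | k. 1 \<le> k \<and> k < length \<alpha>}"

definition ribbon :: "nat list \<Rightarrow> series" where
  "ribbon \<alpha> = (let n = sum_list \<alpha> in
     formal_sum
       {\<kappa> \<in> colorings n. \<forall>i\<in>{1..<n}.
          (i \<in> comp_set \<alpha> \<longrightarrow> \<kappa> i < \<kappa> (i + 1)) \<and> (i \<notin> comp_set \<alpha> \<longrightarrow> \<kappa> i \<ge> \<kappa> (i + 1))}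
       (coloring_monomial n))"

text \<open>Finite sequences are lists, with entries indexed from 1.\<close>

definition entry :: "nat list \<Rightarrow> nat \<Rightarrow> nat" where
  "entry v i = v ! (i - 1)"

definition seq_sum :: "nat list \<Rightarrow> nat set \<Rightarrow> nat" where
  "seq_sum v S = (\<Sum>s\<in>S. entry v s)"


section \<open>Unit interval graphs and unicellular LLT polynomials\<close>

record graph =
  nverts :: nat
  edges :: "(nat \<times> nat) set"

text \<open>
  Vertex sets are [n] with n positive: the area sequence has length n - 1, so it would not
  separate n = 0 from n = 1.
\<close>

definition unit_interval_graph :: "graph \<Rightarrow> bool" where
  "unit_interval_graph G \<longleftrightarrow>
     1 \<le> nverts G \<and>
     edges G \<subseteq> {(i, j). 1 \<le> i \<and> i < j \<and> j \<le> nverts G} \<and>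
     (\<forall>i j k l. (i, j) \<in> edges G \<and> i \<le> k \<and> k < l \<and> l \<le> j \<longrightarrow> (k, l) \<in> edges G)"

definition area_seq :: "graph \<Rightarrow> nat list" where
  "area_seq G = map (\<lambda>i. Max ({0} \<union> {j - i | j. (i, j) \<in> edges G})) [1..<nverts G]"

definition asc :: "graph \<Rightarrow> (nat \<Rightarrow> nat) \<Rightarrow> nat" where
  "asc G \<kappa> = card {(i, j) \<in> edges G. i < j \<and> \<kappa> i < \<kappa> j}"

definition LLT_graph :: "graph \<Rightarrow> series" where
  "LLT_graph G = formal_sum (colorings (nverts G))
     (\<lambda>\<kappa>. scale_series (monom 1 (asc G \<kappa>)) (coloring_monomial (nverts G) \<kappa>))"

definition LLT :: "nat list \<Rightarrow> series" where
  "LLT a = LLT_graph (THE G. unit_interval_graph G \<and> area_seq G = a)"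


section \<open>Melting lollipops\<close>

definition complete_graph :: "nat \<Rightarrow> graph" where
  "complete_graph n = \<lparr>nverts = n, edges = {(i, j). 1 \<le> i \<and> i < j \<and> j \<le> n}\<rparr>"

definition path_graph :: "nat \<Rightarrow> graph" where
  "path_graph n = \<lparr>nverts = n, edges = {(i, i + 1) | i. 1 \<le> i \<and> i + 1 \<le> n}\<rparr>"

definition reverse_graph :: "graph \<Rightarrow> graph" where
  "reverse_graph G =
     \<lparr>nverts = nverts G,
      edges = {(nverts G + 1 - j, nverts G + 1 - i) | i j. (i, j) \<in> edges G}\<rparr>"

definition concat_graph :: "graph \<Rightarrow> graph \<Rightarrow> graph" where
  "concat_graph G H =
     \<lparr>nverts = nverts G + nverts H - 1,
      edges = edges G \<union> {(i + nverts G - 1, j + nverts G - 1) | i j. (i, j) \<in> edges H}\<rparr>"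

definition melting_complete_graph :: "nat \<Rightarrow> nat \<Rightarrow> graph" where
  "melting_complete_graph m k =
     \<lparr>nverts = m, edges = edges (complete_graph m) - {(1, j) | j. m - k + 1 \<le> j \<and> j \<le> m}\<rparr>"

text \<open>The parameter \<open>n\<close> may be -1, in which case the middle path is a single vertex.\<close>

definition melting_lollipop :: "nat \<Rightarrow> nat \<Rightarrow> int \<Rightarrow> nat \<Rightarrow> nat \<Rightarrow> graph" where
  "melting_lollipop m1 k1 n m2 k2 =
     concat_graph
       (concat_graph (reverse_graph (melting_complete_graph m1 k1)) (path_graph (nat (n + 2))))
       (melting_complete_graph m2 k2)"

definition modified_seq :: "nat \<Rightarrow> nat \<Rightarrow> nat list \<Rightarrow> nat list" where
  "modified_seq m1 k1 a =
     map (\<lambda>i. if i + 2 \<le> m1 then i else if i + 1 = m1 then m1 - k1 - 1 else entry a i)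
       [1..<length a + 1]"


section \<open>Well-definedness\<close>

lemma sum_series_apply: "sum f A (M :: nat multiset) = (\<Sum>a\<in>A. f a M :: int poly)"
  by (induction A rule: infinite_finite_induct) auto

lemma finite_coloring_fibre:
  "finite {\<kappa> \<in> colorings n. image_mset \<kappa> (mset_set {1..n}) = M}"
proof (rule finite_subset)
  show "{\<kappa> \<in> colorings n. image_mset \<kappa> (mset_set {1..n}) = M} \<subseteq> {1..n} \<rightarrow>\<^sub>E set_mset M"
    unfolding colorings_def PiE_iff by (intro subsetI) (simp add: PiE_iff, fastforce)
  show "finite ({1..n} \<rightarrow>\<^sub>E set_mset M)"
    by (intro finite_PiE) auto
qed

lemma finite_coloring_support:
  "finite {\<kappa> \<in> colorings n. scale_series (c \<kappa>) (coloring_monomial n \<kappa>) M \<noteq> 0}"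
  by (rule finite_subset[OF _ finite_coloring_fibre[of n M]])
     (auto simp: scale_series_def coloring_monomial_def monomial_series_def split: if_splits)

lemma formal_sum_colorings:
  assumes "K \<subseteq> colorings n"
  shows "formal_sum K (\<lambda>\<kappa>. scale_series (c \<kappa>) (coloring_monomial n \<kappa>)) M =
    (\<Sum>\<kappa>\<in>{\<kappa> \<in> K. image_mset \<kappa> (mset_set {1..n}) = M}. c \<kappa>)"
proof -
  have "finite {\<kappa> \<in> K. image_mset \<kappa> (mset_set {1..n}) = M}"
    by (rule finite_subset[OF _ finite_coloring_fibre[of n M]]) (use assms in auto)
  then show ?thesis
    unfolding formal_sum_def
    by (intro sum.mono_neutral_cong_left)
       (auto simp: scale_series_def coloring_monomial_def monomial_series_def split: if_splits)
qed

lemma finite_compositions: "finite (compositions n)"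
proof (rule finite_subset)
  show "compositions n \<subseteq> {\<alpha>. set \<alpha> \<subseteq> {..n} \<and> length \<alpha> \<le> n}"
  proof
    fix \<alpha> assume "\<alpha> \<in> compositions n"
    then have pos: "\<forall>p\<in>set \<alpha>. 1 \<le> p" and s: "sum_list \<alpha> = n"
      by (auto simp: compositions_def)
    from pos have "length \<alpha> \<le> sum_list \<alpha>"
      by (induction \<alpha>) auto
    with s show "\<alpha> \<in> {\<alpha>. set \<alpha> \<subseteq> {..n} \<and> length \<alpha> \<le> n}"
      using member_le_sum_list[of _ \<alpha>] by auto
  qed
  show "finite {\<alpha>. set \<alpha> \<subseteq> {..n} \<and> length \<alpha> \<le> n}"
    by (rule finite_lists_length_le) simp
qed

lemma length_area_seq [simp]: "length (area_seq G) = nverts G - 1"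
  by (simp add: area_seq_def)

lemma entry_area_seq:
  assumes "1 \<le> i" "i < nverts G"
  shows "entry (area_seq G) i = Max ({0} \<union> {j - i | j. (i, j) \<in> edges G})"
proof -
  have "[1..<nverts G] ! (i - 1) = i" using assms by (subst nth_upt) auto
  with assms show ?thesis unfolding entry_def area_seq_def by (subst nth_map) auto
qed

lemma unit_interval_edge_iff:
  assumes G: "unit_interval_graph G"
  shows "(i, j) \<in> edges G \<longleftrightarrow>
    1 \<le> i \<and> i < j \<and> j \<le> nverts G \<and> j - i \<le> entry (area_seq G) i"
proof (cases "1 \<le> i \<and> i < j \<and> j \<le> nverts G")
  case True
  let ?A = "{0} \<union> {j - i | j. (i, j) \<in> edges G}"
  have "{j - i | j. (i, j) \<in> edges G} \<subseteq> {..nverts G}"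
    using G by (auto simp: unit_interval_graph_def)
  then have fin: "finite ?A"
    using finite_subset by blast
  have e: "entry (area_seq G) i = Max ?A"
    using True by (intro entry_area_seq) auto
  show ?thesis
  proof
    assume "(i, j) \<in> edges G"
    then have "j - i \<le> Max ?A"
      by (intro Max_ge[OF fin]) auto
    with True e show "1 \<le> i \<and> i < j \<and> j \<le> nverts G \<and> j - i \<le> entry (area_seq G) i"
      by auto
  next
    assume "1 \<le> i \<and> i < j \<and> j \<le> nverts G \<and> j - i \<le> entry (area_seq G) i"
    then have le: "j - i \<le> Max ?A" by (simp add: e)
    have "Max ?A \<in> ?A" using fin by (intro Max_in) auto
    then obtain l where l: "(i, l) \<in> edges G" "Max ?A = l - i"
      using le True by auto
    then have "j \<le> l" using le True by auto
    with l G True show "(i, j) \<in> edges G"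
      unfolding unit_interval_graph_def by blast
  qed
next
  case False
  then show ?thesis using G by (auto simp: unit_interval_graph_def)
qed

lemma area_seq_inject:
  assumes G: "unit_interval_graph G" and H: "unit_interval_graph H"
    and eq: "area_seq G = area_seq H"
  shows "G = H"
proof -
  have "nverts G - 1 = nverts H - 1"
    using arg_cong[OF eq, of length] by simp
  then have n: "nverts G = nverts H"
    using G H unfolding unit_interval_graph_def by linarith
  have "(i, j) \<in> edges G \<longleftrightarrow> (i, j) \<in> edges H" for i j
    by (simp add: unit_interval_edge_iff[OF G] unit_interval_edge_iff[OF H] n eq)
  then have "edges G = edges H" by auto
  with n show ?thesis by simp
qed

lemma LLT_area_seq:
  assumes "unit_interval_graph G"
  shows "LLT (area_seq G) = LLT_graph G"
proof -
  have "(THE H. unit_interval_graph H \<and> area_seq H = area_seq G) = G"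
    using assms area_seq_inject by (intro the_equality) auto
  then show ?thesis by (simp add: LLT_def)
qed

lemma unit_interval_path: "1 \<le> n \<Longrightarrow> unit_interval_graph (path_graph n)"
  by (auto simp: unit_interval_graph_def path_graph_def)

lemma unit_interval_melting_complete:
  "1 \<le> m \<Longrightarrow> unit_interval_graph (melting_complete_graph m k)"
  unfolding unit_interval_graph_def melting_complete_graph_def complete_graph_def by auto

lemma unit_interval_reverse:
  assumes "unit_interval_graph G"
  shows "unit_interval_graph (reverse_graph G)"
proof -
  let ?n = "nverts G"
  have sub: "\<And>i j. (i, j) \<in> edges G \<Longrightarrow> 1 \<le> i \<and> i < j \<and> j \<le> ?n"
    and cl: "\<And>i j k l. (i, j) \<in> edges G \<Longrightarrow> i \<le> k \<Longrightarrow> k < l \<Longrightarrow> l \<le> j \<Longrightarrow> (k, l) \<in> edges G"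
    and n: "1 \<le> ?n"
    using assms unfolding unit_interval_graph_def by blast+
  have "(k, l) \<in> edges (reverse_graph G)"
    if ij: "(i, j) \<in> edges (reverse_graph G)" and kl: "i \<le> k" "k < l" "l \<le> j" for i j k l
  proof -
    obtain i' j' where e: "(i', j') \<in> edges G" "i = ?n + 1 - j'" "j = ?n + 1 - i'"
      using ij by (auto simp: reverse_graph_def)
    have "(?n + 1 - l, ?n + 1 - k) \<in> edges G"
      by (rule cl[OF e(1)]) (use kl e sub[OF e(1)] in auto)
    moreover have "k = ?n + 1 - (?n + 1 - k)" "l = ?n + 1 - (?n + 1 - l)"
      using kl e sub[OF e(1)] by auto
    ultimately show ?thesis unfolding reverse_graph_def by auto
  qed
  moreover have "edges (reverse_graph G) \<subseteq> {(i, j). 1 \<le> i \<and> i < j \<and> j \<le> nverts (reverse_graph G)}"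
    by (auto simp: reverse_graph_def dest!: sub)
  moreover have "1 \<le> nverts (reverse_graph G)" using n by (simp add: reverse_graph_def)
  ultimately show ?thesis unfolding unit_interval_graph_def by blast
qed

lemma unit_interval_concat:
  assumes "unit_interval_graph G" "unit_interval_graph H"
  shows "unit_interval_graph (concat_graph G H)"
proof -
  let ?n = "nverts G" and ?m = "nverts H"
  let ?C = "concat_graph G H"
  have subG: "\<And>i j. (i, j) \<in> edges G \<Longrightarrow> 1 \<le> i \<and> i < j \<and> j \<le> ?n"
    and clG: "\<And>i j k l. (i, j) \<in> edges G \<Longrightarrow> i \<le> k \<Longrightarrow> k < l \<Longrightarrow> l \<le> j \<Longrightarrow> (k, l) \<in> edges G"
    and n: "1 \<le> ?n"
    using assms(1) unfolding unit_interval_graph_def by blast+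
  have subH: "\<And>i j. (i, j) \<in> edges H \<Longrightarrow> 1 \<le> i \<and> i < j \<and> j \<le> ?m"
    and clH: "\<And>i j k l. (i, j) \<in> edges H \<Longrightarrow> i \<le> k \<Longrightarrow> k < l \<Longrightarrow> l \<le> j \<Longrightarrow> (k, l) \<in> edges H"
    and m: "1 \<le> ?m"
    using assms(2) unfolding unit_interval_graph_def by blast+
  have "(k, l) \<in> edges ?C" if ij: "(i, j) \<in> edges ?C" and kl: "i \<le> k" "k < l" "l \<le> j" for i j k l
  proof (cases "(i, j) \<in> edges G")
    case True
    then show ?thesis using clG kl by (auto simp: concat_graph_def)
  next
    case False
    then obtain i' j' where e: "(i', j') \<in> edges H" "i = i' + ?n - 1" "j = j' + ?n - 1"
      using ij by (auto simp: concat_graph_def)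
    have "(k + 1 - ?n, l + 1 - ?n) \<in> edges H"
      by (rule clH[OF e(1)]) (use kl e subH[OF e(1)] n in auto)
    moreover have "k = (k + 1 - ?n) + ?n - 1" "l = (l + 1 - ?n) + ?n - 1"
      using kl e subH[OF e(1)] n by auto
    ultimately show ?thesis unfolding concat_graph_def by auto
  qed
  moreover have "edges ?C \<subseteq> {(i, j). 1 \<le> i \<and> i < j \<and> j \<le> nverts ?C}"
    using n m by (auto simp: concat_graph_def dest!: subG subH)
  moreover have "1 \<le> nverts ?C" using n m by (simp add: concat_graph_def)
  ultimately show ?thesis unfolding unit_interval_graph_def by blast
qed

lemma unit_interval_melting_lollipop:
  assumes "n \<ge> -1" "m1 \<ge> 1" "m2 \<ge> 1"
  shows "unit_interval_graph (melting_lollipop m1 k1 n m2 k2)"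
  using assms unfolding melting_lollipop_def
  by (intro unit_interval_concat unit_interval_reverse unit_interval_melting_complete
      unit_interval_path) auto

lemma nverts_melting_lollipop:
  assumes "n \<ge> -1" "m1 \<ge> 1" "m2 \<ge> 1"
  shows "int (nverts (melting_lollipop m1 k1 n m2 k2)) = int m1 + n + int m2"
  using assms
  by (auto simp: melting_lollipop_def concat_graph_def reverse_graph_def path_graph_def
      melting_complete_graph_def)

end

theory Submission
  imports Defs
begin

text \<open>
  Sorting the colorings by their ascent set $A(\kappa) = \{i : \kappa(i) < \kappa(i+1)\}$ turns the
  right-hand side into the sum of $q^{\mathbf b(A(\kappa))} x^\kappa$, because every subset of
  $[N-1]$ is the set of exactly one composition (\<open>sum_scaled_ribbons\<close>). So the claim is
  that, on colorings of fixed content, the number of ascending edges and the weight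
  $\mathbf b(A(\kappa))$ have the same distribution.

  Both statistics are sums of three parts, one for each piece of the graph (\<open>asc_lollipop\<close>,
  \<open>seq_sum_lollipop\<close>). On the path all weights are 1 and the two parts agree for every
  coloring. A head meets the rest of the graph in a single vertex, so it is enough to show that its
  two parts are equidistributed when the color $c$ of that vertex and the content of the other
  colors are fixed. The left head becomes a right head when positions and the order of the colors are
  both reversed; this is where the entries $1, 2, \dots, m_1-2, m_1-k_1-1$ of $\mathbf b$ come from.
  Working with an abstract strict weak order on the colors treats both heads at once.

  For a right head with further colors $w = w_1 \dots w_L$ and $r = L - k$, the statement is
  (\<open>sum_words_head\<close>)
  $$\sum_w q^{\#\{j \le r : c < w_j\} + \mathrm{asc}(w)} = \sum_w q^{r [c < w_1] + \mathrm{maj}(w)},$$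
  where $\mathrm{asc}$ counts ascending pairs and $\mathrm{maj}$ gives an ascent at $i$ the weight
  $L - i$. It is a form of Foata's proof that inversions and major index are equidistributed. By
  exchanging neighbours of which exactly one exceeds $c$, the factor for $j \le r$ can be replaced by
  $q^{r [c < w_1]}$ (\<open>sum_words_take\<close>): when the letter at the end of the prefix moves to
  the front and exceeds $c$, each step past another letter costs one factor $q$, since either that
  letter leaves the prefix to be counted or an ascent is lost; when it does not exceed $c$, every
  letter that leaves the prefix to be counted becomes the end of a new ascent. After that the factor
  refers only to the first letter, and the equidistribution of $\mathrm{asc}$ and
  $\mathrm{maj}$ with fixed first letter is the case $r = L$ of the statement for words that are one
  letter shorter. This gives an induction on $L$.
\<close>

section \<open>Words and their ascent statistics\<close>

definition words :: "'a set \<Rightarrow> nat \<Rightarrow> 'a list set" where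
  "words X L = {w. set w \<subseteq> X \<and> length w = L}"

fun asc_pairs :: "('a \<Rightarrow> 'a \<Rightarrow> bool) \<Rightarrow> 'a list \<Rightarrow> nat" where
  "asc_pairs R [] = 0"
| "asc_pairs R (x # xs) = length (filter (R x) xs) + asc_pairs R xs"

text \<open>
  An ascent is weighted by the number of letters after its left end. The last letter has the
  unspecified value \<open>hd []\<close> to its right, which is harmless because its weight is 0.
\<close>

fun asc_maj :: "('a \<Rightarrow> 'a \<Rightarrow> bool) \<Rightarrow> 'a list \<Rightarrow> nat" where
  "asc_maj R [] = 0"
| "asc_maj R (x # xs) = (if R x (hd xs) then length xs else 0) + asc_maj R xs"

text \<open>
  The two statistics of a right head whose first vertex has color \<open>c\<close> and is adjacent to
  the next \<open>r\<close> vertices only, the colors of the other vertices being \<open>w\<close>.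
\<close>

definition head_asc :: "('a \<Rightarrow> 'a \<Rightarrow> bool) \<Rightarrow> nat \<Rightarrow> 'a \<Rightarrow> 'a list \<Rightarrow> nat" where
  "head_asc R r c w = length (filter (R c) (take r w)) + asc_pairs R w"

definition head_maj :: "('a \<Rightarrow> 'a \<Rightarrow> bool) \<Rightarrow> nat \<Rightarrow> 'a \<Rightarrow> 'a list \<Rightarrow> nat" where
  "head_maj R r c w = (if R c (hd w) then r else 0) + asc_maj R w"

text \<open>
  Beside \<open><\<close> on the colors, which serves the right head, this covers \<open>>\<close>,
  which serves the left head read backwards.
\<close>

definition strict_weak_order :: "('a \<Rightarrow> 'a \<Rightarrow> bool) \<Rightarrow> bool" where
  "strict_weak_order R \<longleftrightarrow> asymp R \<and> (\<forall>x y z. R x z \<longrightarrow> R x y \<or> R y z)"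

lemma strict_weak_order_less: "strict_weak_order ((<) :: 'a::linorder \<Rightarrow> 'a \<Rightarrow> bool)"
  by (auto simp: strict_weak_order_def intro: asympI)

lemma strict_weak_order_greater: "strict_weak_order ((>) :: 'a::linorder \<Rightarrow> 'a \<Rightarrow> bool)"
  by (auto simp: strict_weak_order_def intro: asympI)

lemma strict_weak_orderD:
  "strict_weak_order R \<Longrightarrow> R c x \<Longrightarrow> \<not> R c y \<Longrightarrow> R y x \<and> \<not> R x y"
  unfolding strict_weak_order_def by (blast dest: asympD)

lemma words_0 [simp]: "words X 0 = {[]}"
  by (auto simp: words_def)

text \<open>
  Sums run over all words on an alphabet, and the content is fixed by a weight that depends on the
  multiset of letters. Sums over concatenations are then iterated sums, without a
  summation over the ways to split the content.
\<close>

lemma sum_words_append: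
  "(\<Sum>w\<in>words X (K + L). f w) = (\<Sum>u\<in>words X K. \<Sum>v\<in>words X L. f (u @ v))"
proof -
  have "(\<Sum>w\<in>words X (K + L). f w) = (\<Sum>(u, v)\<in>words X K \<times> words X L. f (u @ v))"
    by (rule sum.reindex_bij_witness[of _ "\<lambda>(u, v). u @ v" "\<lambda>w. (take K w, drop K w)"])
       (auto simp: words_def dest: in_set_takeD in_set_dropD)
  then show ?thesis by (simp add: sum.cartesian_product)
qed

lemma sum_words_Suc:
  "(\<Sum>w\<in>words X (Suc L). f w) = (\<Sum>x\<in>X. \<Sum>w\<in>words X L. f (x # w))"
proof -
  have "(\<Sum>w\<in>words X (Suc L). f w) = (\<Sum>(x, w)\<in>X \<times> words X L. f (x # w))"
    by (rule sum.reindex_bij_witness[of _ "\<lambda>(x, w). x # w" "\<lambda>w. (hd w, tl w)"])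
       (auto simp: words_def length_Suc_conv)
  then show ?thesis by (simp add: sum.cartesian_product)
qed

lemma sum_words_rev: "(\<Sum>w\<in>words X L. f (rev w)) = (\<Sum>w\<in>words X L. f w)"
  by (rule sum.reindex_bij_witness[of _ rev rev]) (auto simp: words_def)

lemma asc_pairs_swap:
  "asc_pairs R (p @ x # y # z) + of_bool (R y x) = asc_pairs R (p @ y # x # z) + of_bool (R x y)"
  by (induction p) auto

section \<open>One head\<close>

text \<open>
  The position whose letter is compared with \<open>c\<close> can be moved from \<open>r\<close> to the
  front. One step from \<open>Suc r\<close> to \<open>r\<close> is the involution that exchanges the
  letters at these positions if exactly one of them lies above \<open>c\<close>. A small marked letter
  that passes a large one in this way exchanges a member of the prefix for an ascent, so that the
  weight stays the same. A marked letter that is large loses an ascent if its neighbour is small; if the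
  neighbour is large, only the mark moves, and the prefix loses that neighbour. Either way the
  exponent drops by 1, and after \<open>r\<close> steps the factor \<open>q ^ r\<close> makes up for it.
\<close>

lemma sum_words_move_front:
  fixes q :: "'b::comm_semiring_1"
  assumes R: "strict_weak_order R" and "r < L"
  shows "(\<Sum>w\<in>words X L. H (mset w) * q ^ (asc_pairs R w + length (filter (R c) (take r w))) * g (R c (w ! r)))
       = (\<Sum>w\<in>words X L. H (mset w) * q ^ asc_pairs R w * (if R c (hd w) then q ^ r * g True else g False))"
  using \<open>r < L\<close>
proof (induction r arbitrary: g)
  case 0
  then show ?case
    by (intro sum.cong refl) (auto simp: words_def hd_conv_nth)
next
  case (Suc r)
  \<comment> \<open>Pushing the marked position one place to the front absorbs one factor into the weight.\<close>
  define g' where "g' = (\<lambda>b. if b then q * g True else g False)"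
  define t where "t = (\<lambda>w. if R c (w ! r) = R c (w ! Suc r) then w
                          else w[r := w ! Suc r, Suc r := w ! r])"
  have split: "\<exists>p y x z. w = p @ y # x # z \<and> length p = r" if "w \<in> words X L" for w
  proof -
    have "length w = L" using that by (simp add: words_def)
    then have "w = take r w @ w ! r # w ! Suc r # drop (Suc (Suc r)) w"
      using Suc.prems by (simp add: Cons_nth_drop_Suc)
    then show ?thesis using Suc.prems \<open>length w = L\<close>
      by (metis Suc_lessD length_take min.absorb4)
  qed
  have t: "t (p @ y # x # z) = (if R c y = R c x then p @ y # x # z else p @ x # y # z)"
    if "length p = r" for p x y z
    using that by (simp add: t_def nth_append list_update_append)
  have t_words: "t w \<in> words X L" and t_t: "t (t w) = w" if w: "w \<in> words X L" for w
  proof -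
    obtain p y x z where pyxz: "w = p @ y # x # z" "length p = r" using split[OF w] by blast
    show "t w \<in> words X L" using w pyxz t[of p] by (auto simp: words_def)
    show "t (t w) = w" using pyxz t[of p] by auto
  qed
  have weight: "H (mset (t w)) * q ^ (asc_pairs R (t w) + length (filter (R c) (take r (t w)))) * g' (R c (t w ! r))
        = H (mset w) * q ^ (asc_pairs R w + length (filter (R c) (take (Suc r) w))) * g (R c (w ! Suc r))"
    if w: "w \<in> words X L" for w
  proof -
    obtain p y x z where pyxz: "w = p @ y # x # z" "length p = r" using split[OF w] by blast
    show ?thesis
    proof (cases "R c y = R c x")
      case True
      then show ?thesis using pyxz t[of p]
        by (auto simp: g'_def nth_append mult_ac add_mset_commute)
    next
      case False
      have e: "asc_pairs R (p @ x # y # z) + of_bool (R c x) = asc_pairs R (p @ y # x # z) + of_bool (R c y)"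
        using asc_pairs_swap[of R p x y z] strict_weak_orderD[OF R, of c x y]
          strict_weak_orderD[OF R, of c y x] False by auto
      show ?thesis
      proof (cases "R c x")
        case True
        then have "asc_pairs R (p @ y # x # z) = Suc (asc_pairs R (p @ x # y # z))"
          using e False by simp
        then show ?thesis using pyxz t[of p] False True
          by (simp add: g'_def nth_append mult_ac add_ac add_mset_commute)
      next
        case f: False
        then have "asc_pairs R (p @ x # y # z) = Suc (asc_pairs R (p @ y # x # z))"
          using e False by simp
        then show ?thesis using pyxz t[of p] False f
          by (simp add: g'_def nth_append mult_ac add_ac add_mset_commute)
      qed
    qed
  qed
  have "(\<Sum>w\<in>words X L. H (mset w) * q ^ (asc_pairs R w + length (filter (R c) (take (Suc r) w))) * g (R c (w ! Suc r)))
      = (\<Sum>w\<in>words X L. H (mset w) * q ^ (asc_pairs R w + length (filter (R c) (take r w))) * g' (R c (w ! r)))"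
    by (rule sum.reindex_bij_witness[of _ t t]) (simp_all only: t_words t_t weight)
  also have "\<dots> = (\<Sum>w\<in>words X L. H (mset w) * q ^ asc_pairs R w * (if R c (hd w) then q ^ r * g' True else g' False))"
    using Suc by simp
  also have "\<dots> = (\<Sum>w\<in>words X L. H (mset w) * q ^ asc_pairs R w * (if R c (hd w) then q ^ Suc r * g True else g False))"
    by (intro sum.cong refl) (simp add: g'_def mult_ac)
  finally show ?case .
qed

text \<open>
  The last letter of the prefix is the marked letter of \<open>sum_words_move_front\<close>, with the
  weight \<open>q\<close> if it is large and 1 if not.
\<close>

lemma sum_words_take:
  fixes q :: "'b::comm_semiring_1"
  assumes R: "strict_weak_order R" and "r \<le> L"
  shows "(\<Sum>w\<in>words X L. H (mset w) * q ^ (asc_pairs R w + length (filter (R c) (take r w))))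
       = (\<Sum>w\<in>words X L. H (mset w) * q ^ (asc_pairs R w + (if R c (hd w) then r else 0)))"
proof (cases r)
  case (Suc r')
  have "(\<Sum>w\<in>words X L. H (mset w) * q ^ (asc_pairs R w + length (filter (R c) (take r w))))
      = (\<Sum>w\<in>words X L. H (mset w) * q ^ (asc_pairs R w + length (filter (R c) (take r' w)))
            * (if R c (w ! r') then q else 1))"
    using Suc \<open>r \<le> L\<close>
    by (intro sum.cong refl) (auto simp: words_def take_Suc_conv_app_nth mult_ac)
  also have "\<dots> = (\<Sum>w\<in>words X L. H (mset w) * q ^ asc_pairs R w * (if R c (hd w) then q ^ r' * q else 1))"
    using sum_words_move_front[OF R, where X = X and L = L and r = r' and H = H and q = q and c = c
        and g = "\<lambda>b. if b then q else 1"] Suc \<open>r \<le> L\<close> by simp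
  also have "\<dots> = (\<Sum>w\<in>words X L. H (mset w) * q ^ (asc_pairs R w + (if R c (hd w) then r else 0)))"
    using Suc by (intro sum.cong refl) (simp add: power_add mult_ac)
  finally show ?thesis .
next
  case 0
  then have "(if R c x then r else 0) = 0" for x by simp
  then show ?thesis using 0 by simp
qed

text \<open>
  Splitting off the first letter \<open>x\<close> of \<open>w\<close> leaves a head with
  \<open>c = x\<close> and \<open>r = L\<close> on the remaining \<open>L\<close> letters, with a weight
  that still depends on the content only, since \<open>x\<close> is a constant there. So the induction
  hypothesis replaces \<open>asc_maj\<close> by \<open>asc_pairs\<close> without touching the first
  letter, and \<open>sum_words_take\<close> deals with the term for \<open>c\<close>.
\<close>

lemma sum_words_head:
  fixes q :: "'b::comm_semiring_1"
  assumes R: "strict_weak_order R" and "r \<le> L"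
  shows "(\<Sum>w\<in>words X L. H (mset w) * q ^ head_maj R r c w)
       = (\<Sum>w\<in>words X L. H (mset w) * q ^ head_asc R r c w)"
  unfolding head_maj_def head_asc_def
  using \<open>r \<le> L\<close>
proof (induction L arbitrary: r c H)
  case 0
  then show ?case by simp
next
  case (Suc L)
  let ?e = "\<lambda>x. if R c x then r else 0"
  have "(\<Sum>w\<in>words X (Suc L). H (mset w) * q ^ (?e (hd w) + asc_maj R w))
      = (\<Sum>x\<in>X. \<Sum>w\<in>words X L. (H (add_mset x (mset w)) * q ^ ?e x)
            * q ^ ((if R x (hd w) then L else 0) + asc_maj R w))"
    unfolding sum_words_Suc
  proof (intro sum.cong refl, goal_cases)
    case (1 x w)
    then have "length w = L" by (simp add: words_def)
    then show ?case by (simp add: power_add mult_ac)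
  qed
  also have "\<dots> = (\<Sum>x\<in>X. \<Sum>w\<in>words X L. (H (add_mset x (mset w)) * q ^ ?e x)
            * q ^ (length (filter (R x) (take L w)) + asc_pairs R w))"
    by (intro sum.cong refl Suc.IH[where H = "\<lambda>M. H (add_mset _ M) * q ^ ?e _"]) simp
  also have "\<dots> = (\<Sum>w\<in>words X (Suc L). H (mset w) * q ^ (asc_pairs R w + ?e (hd w)))"
    unfolding sum_words_Suc
  proof (intro sum.cong refl, goal_cases)
    case (1 x w)
    then have "take L w = w" by (simp add: words_def)
    then show ?case by (simp add: power_add mult_ac)
  qed
  also have "\<dots> = (\<Sum>w\<in>words X (Suc L). H (mset w) * q ^ (asc_pairs R w + length (filter (R c) (take r w))))"
    by (rule sum_words_take[symmetric, OF R Suc.prems])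
  finally show ?case by (simp add: add.commute)
qed

section \<open>Two heads joined by a path\<close>

text \<open>
  The word \<open>u\<close> colors the left head without its joining vertex, \<open>p @ [d]\<close> the
  path, and \<open>v\<close> the right head without its joining vertex \<open>d\<close>. The joining
  vertex on the left is the first one of \<open>p @ [d]\<close>; it coincides with \<open>d\<close> if
  \<open>p\<close> is empty. As the heads interact only through \<open>p\<close>, \<open>d\<close> and
  the common content, each of them is treated by \<open>sum_words_head\<close> with everything else
  fixed.
\<close>

lemma sum_words_two_heads:
  fixes q :: "'b::comm_semiring_1" and X :: "'a::linorder set"
  assumes "r1 \<le> L1" "r2 \<le> L2"
  shows "(\<Sum>u\<in>words X L1. \<Sum>p\<in>words X P. \<Sum>d\<in>X. \<Sum>v\<in>words X L2.
            H (mset (u @ p @ d # v)) *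
            q ^ (head_maj (>) r1 (hd (p @ [d])) (rev u) + g p d + head_maj (<) r2 d v))
       = (\<Sum>u\<in>words X L1. \<Sum>p\<in>words X P. \<Sum>d\<in>X. \<Sum>v\<in>words X L2.
            H (mset (u @ p @ d # v)) *
            q ^ (head_asc (>) r1 (hd (p @ [d])) (rev u) + g p d + head_asc (<) r2 d v))"
    (is "?M = ?A")
proof -
  let ?c = "\<lambda>p d. hd (p @ [d])"
  define F where "F = (\<lambda>s t. \<Sum>p\<in>words X P. \<Sum>d\<in>X. \<Sum>v\<in>words X L2. \<Sum>u\<in>words X L1.
            H (mset u + mset (p @ d # v)) * q ^ (s (?c p d) u + g p d + t d v) :: 'b)"
  have F: "(\<Sum>u\<in>words X L1. \<Sum>p\<in>words X P. \<Sum>d\<in>X. \<Sum>v\<in>words X L2.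
            H (mset (u @ p @ d # v)) * q ^ (s (?c p d) (rev u) + g p d + t d v)) = F s t" for s t
  proof -
    have "F s t = (\<Sum>p\<in>words X P. \<Sum>d\<in>X. \<Sum>v\<in>words X L2. \<Sum>u\<in>words X L1.
            H (mset (rev u) + mset (p @ d # v)) * q ^ (s (?c p d) (rev u) + g p d + t d v))"
      unfolding F_def
      by (intro sum.cong refl sum_words_rev[symmetric, where
            f = "\<lambda>u. H (mset u + mset (_ @ _ # _)) * q ^ (s (?c _ _) u + g _ _ + t _ _)"])
    also have "\<dots> = (\<Sum>u\<in>words X L1. \<Sum>p\<in>words X P. \<Sum>d\<in>X. \<Sum>v\<in>words X L2.
            H (mset (u @ p @ d # v)) * q ^ (s (?c p d) (rev u) + g p d + t d v))"
      unfolding sum.swap[of _ "words X L1" "words X L2"] sum.swap[of _ "words X L1" X]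
        sum.swap[of _ "words X L1" "words X P"]
      by (simp only: mset_append mset_rev)
    finally show ?thesis by simp
  qed
  have left: "(\<Sum>u\<in>words X L1. H (mset u + mset (p @ d # v)) * q ^ (head_maj (>) r1 (?c p d) u + g p d + t))
      = (\<Sum>u\<in>words X L1. H (mset u + mset (p @ d # v)) * q ^ (head_asc (>) r1 (?c p d) u + g p d + t))"
    for p d v t
    using sum_words_head[OF strict_weak_order_greater assms(1), where X = X and q = q and c = "?c p d" and
            H = "\<lambda>U. H (U + mset (p @ d # v)) * q ^ (g p d + t)"]
    by (simp add: power_add mult_ac)
  have right: "(\<Sum>v\<in>words X L2. H (mset u + mset (p @ d # v)) * q ^ (s + g p d + head_maj (<) r2 d v))
      = (\<Sum>v\<in>words X L2. H (mset u + mset (p @ d # v)) * q ^ (s + g p d + head_asc (<) r2 d v))"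
    for u p d s
    using sum_words_head[OF strict_weak_order_less assms(2), where X = X and q = q and c = d and
            H = "\<lambda>V. H (mset u + (mset (p @ [d]) + V)) * q ^ (s + g p d)"]
    by (simp add: power_add mult_ac)
  have "?M = F (head_maj (>) r1) (head_maj (<) r2)" by (rule F)
  also have "\<dots> = F (head_asc (>) r1) (head_maj (<) r2)"
    unfolding F_def by (intro sum.cong refl left)
  also have "\<dots> = F (head_asc (>) r1) (head_asc (<) r2)"
    unfolding F_def sum.swap[of _ "words X L1" "words X L2"] by (intro sum.cong refl right)
  also have "\<dots> = ?A" by (rule F[symmetric])
  finally show ?thesis .
qed

section \<open>Ascent sets and ribbons\<close>

lemma comp_set_single [simp]: "comp_set [p] = {}" "comp_set [] = {}"
  by (auto simp: comp_set_def)

lemma comp_set_Cons: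
  assumes "\<alpha> \<noteq> []"
  shows "comp_set (p # \<alpha>) = insert p ((+) p ` comp_set \<alpha>)"
proof -
  have im: "comp_set \<beta> = (\<lambda>k. sum_list (take k \<beta>)) ` {1..<length \<beta>}" for \<beta> :: "nat list"
    by (auto simp: comp_set_def)
  have "{1..<length (p # \<alpha>)} = insert 1 (Suc ` {1..<length \<alpha>})"
    using assms by (cases \<alpha>) (auto simp: image_Suc_atLeastLessThan)
  then show ?thesis unfolding im by (simp add: image_image del: image_Suc_atLeastLessThan)
qed

lemma compositions_Cons: "p # \<alpha> \<in> compositions n \<longleftrightarrow> 1 \<le> p \<and> p \<le> n \<and> \<alpha> \<in> compositions (n - p)"
  by (auto simp: compositions_def)

lemma compositions_0: "compositions 0 = {[]}"
proof -
  have "\<alpha> \<in> compositions 0 \<longleftrightarrow> \<alpha> = []" for \<alpha>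
    by (cases \<alpha>) (auto simp: compositions_Cons, auto simp: compositions_def)
  then show ?thesis by blast
qed

lemma comp_set_bounds: "\<alpha> \<in> compositions n \<Longrightarrow> comp_set \<alpha> \<subseteq> {1..<n}"
proof (induction \<alpha> arbitrary: n)
  case (Cons p \<alpha>)
  show ?case
  proof (cases "\<alpha> = []")
    case False
    have p: "1 \<le> p" "p \<le> n" and \<alpha>: "\<alpha> \<in> compositions (n - p)"
      using Cons.prems by (auto simp: compositions_Cons)
    have "n - p \<noteq> 0" using \<alpha> False by (auto simp: compositions_0)
    then show ?thesis using Cons.IH[OF \<alpha>] p False by (force simp: comp_set_Cons)
  qed simp
qed simp

text \<open>
  The first part of a composition with at least two parts is the least element of its set, and the
  remaining parts form the composition of the shifted rest of the set.
\<close>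

lemma ex1_composition:
  assumes "1 \<le> n" "S \<subseteq> {1..<n}"
  shows "\<exists>!\<alpha>. \<alpha> \<in> compositions n \<and> comp_set \<alpha> = S"
  using assms
proof (induction n arbitrary: S rule: less_induct)
  case (less n)
  have ne: "\<alpha> \<noteq> []" if "\<alpha> \<in> compositions n" for \<alpha>
    using that less.prems by (auto simp: compositions_def)
  show ?case
  proof (cases "S = {}")
    case True
    show ?thesis
    proof (rule ex1I[of _ "[n]"])
      fix \<alpha> assume a: "\<alpha> \<in> compositions n \<and> comp_set \<alpha> = S"
      then obtain p \<beta> where \<alpha>: "\<alpha> = p # \<beta>" using ne by (cases \<alpha>) auto
      with a True have "\<beta> = []" using comp_set_Cons[of \<beta> p] by auto
      with a \<alpha> show "\<alpha> = [n]" by (auto simp: compositions_def)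
    qed (use True less.prems in \<open>auto simp: compositions_def\<close>)
  next
    case False
    have fin: "finite S" using less.prems finite_subset by blast
    define p where "p = Min S"
    have p: "p \<in> S" "\<And>s. s \<in> S \<Longrightarrow> p \<le> s" unfolding p_def using fin False by auto
    then have pn: "1 \<le> p" "p < n" using less.prems by auto
    define T where "T = {s. 0 < s \<and> p + s \<in> S}"
    have S: "S = insert p ((+) p ` T)"
    proof
      show "S \<subseteq> insert p ((+) p ` T)"
      proof
        fix s assume s: "s \<in> S"
        then have "s = p \<or> s = p + (s - p) \<and> s - p \<in> T" using p(2)[OF s] by (auto simp: T_def)
        then show "s \<in> insert p ((+) p ` T)" by blast
      qed
    qed (auto simp: T_def p)
    have T: "T \<subseteq> {1..<n - p}" using less.prems by (force simp: T_def)
    have "\<exists>!\<beta>. \<beta> \<in> compositions (n - p) \<and> comp_set \<beta> = T"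
      using pn T by (intro less.IH) auto
    then obtain \<beta> where \<beta>: "\<beta> \<in> compositions (n - p)" "comp_set \<beta> = T"
      and uniq: "\<And>\<gamma>. \<gamma> \<in> compositions (n - p) \<Longrightarrow> comp_set \<gamma> = T \<Longrightarrow> \<gamma> = \<beta>" by blast
    have "\<beta> \<noteq> []" using \<beta> pn by (auto simp: compositions_def)
    show ?thesis
    proof (rule ex1I[of _ "p # \<beta>"])
      show "p # \<beta> \<in> compositions n \<and> comp_set (p # \<beta>) = S"
        using \<beta> pn \<open>\<beta> \<noteq> []\<close> S by (simp add: compositions_Cons comp_set_Cons)
    next
      fix \<alpha> assume a: "\<alpha> \<in> compositions n \<and> comp_set \<alpha> = S"
      then obtain r \<gamma> where \<alpha>: "\<alpha> = r # \<gamma>" using ne by (cases \<alpha>) auto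
      have g0: "\<gamma> \<noteq> []" using a \<alpha> False by auto
      have g: "\<gamma> \<in> compositions (n - r)" using a \<alpha> by (simp add: compositions_Cons)
      have Sr: "S = insert r ((+) r ` comp_set \<gamma>)" using a \<alpha> comp_set_Cons[OF g0] by simp
      then have "r = p" using p by (metis image_iff insert_iff le_add1 le_antisym)
      moreover have "comp_set \<gamma> = T"
      proof -
        have "0 \<notin> comp_set \<gamma>" using comp_set_bounds[OF g] by auto
        then have "comp_set \<gamma> = {s. 0 < s \<and> r + s \<in> S}" unfolding Sr by (auto intro: gr0I)
        then show ?thesis by (simp add: T_def \<open>r = p\<close>)
      qed
      ultimately show "\<alpha> = p # \<beta>" using uniq g \<alpha> by auto
    qed
  qed
qed

lemma bij_betw_comp_set:
  assumes "1 \<le> n"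
  shows "bij_betw comp_set (compositions n) (Pow {1..<n})"
  unfolding bij_betw_def
proof
  show "inj_on comp_set (compositions n)"
  proof (rule inj_onI)
    fix \<alpha> \<beta> assume "\<alpha> \<in> compositions n" "\<beta> \<in> compositions n" "comp_set \<alpha> = comp_set \<beta>"
    then show "\<alpha> = \<beta>" using ex1_composition[OF assms comp_set_bounds] by metis
  qed
  show "comp_set ` compositions n = Pow {1..<n}"
  proof
    show "Pow {1..<n} \<subseteq> comp_set ` compositions n"
      using ex1_composition[OF assms] by blast
  qed (use comp_set_bounds in blast)
qed

text \<open>
  A coloring contributes to exactly one ribbon, that of the composition whose set is its ascent set.
\<close>

lemma sum_scaled_ribbons:
  assumes "1 \<le> n"
  shows "(\<Sum>\<alpha>\<in>compositions n. scale_series (c (comp_set \<alpha>)) (ribbon \<alpha>)) M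
       = (\<Sum>\<kappa>\<in>{\<kappa> \<in> colorings n. image_mset \<kappa> (mset_set {1..n}) = M}.
            c {i \<in> {1..<n}. \<kappa> i < \<kappa> (i + 1)})"
proof -
  let ?C = "{\<kappa> \<in> colorings n. image_mset \<kappa> (mset_set {1..n}) = M}"
  let ?A = "\<lambda>\<kappa>. {i \<in> {1..<n}. \<kappa> i < \<kappa> (i + 1)}"
  have rib: "ribbon \<alpha> M = (\<Sum>\<kappa>\<in>{\<kappa> \<in> ?C. ?A \<kappa> = comp_set \<alpha>}. 1)" if \<alpha>: "\<alpha> \<in> compositions n" for \<alpha>
  proof -
    let ?K = "{\<kappa> \<in> colorings n. \<forall>i\<in>{1..<n}.
          (i \<in> comp_set \<alpha> \<longrightarrow> \<kappa> i < \<kappa> (i + 1)) \<and> (i \<notin> comp_set \<alpha> \<longrightarrow> \<kappa> i \<ge> \<kappa> (i + 1))}"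
    have n: "sum_list \<alpha> = n" using \<alpha> by (simp add: compositions_def)
    have "coloring_monomial n = (\<lambda>\<kappa>. scale_series 1 (coloring_monomial n \<kappa>))"
      by (simp add: scale_series_def)
    then have "ribbon \<alpha> M = (\<Sum>\<kappa>\<in>{\<kappa> \<in> ?K. image_mset \<kappa> (mset_set {1..n}) = M}. 1)"
      unfolding ribbon_def Let_def n
      using formal_sum_colorings[of ?K n "\<lambda>_. 1" M] by simp
    also have "{\<kappa> \<in> ?K. image_mset \<kappa> (mset_set {1..n}) = M} = {\<kappa> \<in> ?C. ?A \<kappa> = comp_set \<alpha>}"
    proof -
      have e1: "(\<forall>i\<in>{1..<n}. (i \<in> comp_set \<alpha> \<longrightarrow> \<kappa> i < \<kappa> (i + 1)) \<and> (i \<notin> comp_set \<alpha> \<longrightarrow> \<kappa> i \<ge> \<kappa> (i + 1)))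
          \<longleftrightarrow> (\<forall>i\<in>{1..<n}. \<kappa> i < \<kappa> (i + 1) \<longleftrightarrow> i \<in> comp_set \<alpha>)" for \<kappa> :: "nat \<Rightarrow> nat"
        by (meson not_less)
      have e2: "(\<forall>i\<in>{1..<n}. \<kappa> i < \<kappa> (i + 1) \<longleftrightarrow> i \<in> comp_set \<alpha>)
          \<longleftrightarrow> ?A \<kappa> = comp_set \<alpha>" for \<kappa> :: "nat \<Rightarrow> nat"
        using comp_set_bounds[OF \<alpha>] by blast
      show ?thesis unfolding e1 e2 by blast
    qed
    finally show ?thesis .
  qed
  have "(\<Sum>\<alpha>\<in>compositions n. scale_series (c (comp_set \<alpha>)) (ribbon \<alpha>)) M
      = (\<Sum>\<alpha>\<in>compositions n. \<Sum>\<kappa>\<in>{\<kappa> \<in> ?C. ?A \<kappa> = comp_set \<alpha>}. c (?A \<kappa>))"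
    unfolding sum_series_apply
    by (intro sum.cong refl) (simp add: scale_series_def rib sum_distrib_left)
  also have "\<dots> = (\<Sum>S\<in>Pow {1..<n}. \<Sum>\<kappa>\<in>{\<kappa> \<in> ?C. ?A \<kappa> = S}. c (?A \<kappa>))"
    by (rule sum.reindex_bij_betw[OF bij_betw_comp_set[OF assms]])
  also have "\<dots> = (\<Sum>\<kappa>\<in>?C. c (?A \<kappa>))"
    by (rule sum.group[OF finite_coloring_fibre]) auto
  finally show ?thesis .
qed

section \<open>Ascending edges and weighted ascents of a melting lollipop\<close>

text \<open>
  A right head on the vertices \<open>0, ..., L\<close>, in which the vertex 0 has kept its edges to
  \<open>1, ..., r\<close>. The vertices of both heads will be numbered by their offset from the
  joining vertex.
\<close>

definition head_edges :: "nat \<Rightarrow> nat \<Rightarrow> (nat \<times> nat) set" where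
  "head_edges L r = {(i, j). i < j \<and> j \<le> L \<and> (i = 0 \<longrightarrow> j \<le> r)}"

lemma asc_pairs_map_upt:
  "asc_pairs R (map f [a..<b]) = card {(i, j). a \<le> i \<and> i < j \<and> j < b \<and> R (f i) (f j)}"
proof (induction "b - a" arbitrary: a)
  case 0
  then have "{(i, j). a \<le> i \<and> i < j \<and> j < b \<and> R (f i) (f j)} = {}" by auto
  then show ?case using 0 by (simp only: card.empty) simp
next
  case (Suc k)
  then have ab: "a < b" and k: "k = b - Suc a" by auto
  let ?P = "\<lambda>a. {(i, j). a \<le> i \<and> i < j \<and> j < b \<and> R (f i) (f j)}"
  let ?J = "{j \<in> {Suc a..<b}. R (f a) (f j)}"
  have fin: "finite (?P (Suc a))"
    by (rule finite_subset[of _ "{..<b} \<times> {..<b}"]) auto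
  have "?P a = Pair a ` ?J \<union> ?P (Suc a)"
    using ab by (auto simp: image_iff Suc_le_eq order_le_less)
  moreover have "Pair a ` ?J \<inter> ?P (Suc a) = {}" by auto
  ultimately have "card (?P a) = card ?J + card (?P (Suc a))"
    using fin by (simp add: card_Un_disjoint card_image inj_on_def)
  moreover have "length (filter (R (f a)) (map f [Suc a..<b])) = card ?J"
    by (simp add: filter_map o_def flip: distinct_card)
  ultimately show ?case using Suc(1)[OF k] ab by (simp add: upt_conv_Cons)
qed

lemma asc_maj_map_upt:
  "asc_maj R (map f [a..<Suc b]) = (\<Sum>i\<in>{a..<b}. if R (f i) (f (Suc i)) then b - i else 0)"
proof (induction "b - a" arbitrary: a)
  case 0
  then show ?case by (cases "a = b") auto
next
  case (Suc k)
  then have ab: "a < b" and k: "k = b - Suc a" by auto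
  have e: "[a..<Suc b] = a # [Suc a..<Suc b]" "hd (map f [Suc a..<Suc b]) = f (Suc a)"
    using ab by (auto simp: upt_conv_Cons simp del: upt_Suc)
  show ?case unfolding e(1) using Suc(1)[OF k] ab e(2)
    by (simp add: sum.atLeast_Suc_lessThan del: upt_Suc)
qed

lemma head_asc_map:
  assumes "r \<le> L"
  shows "head_asc R r (f 0) (map f [1..<Suc L]) = card {(i, j) \<in> head_edges L r. R (f i) (f j)}"
proof -
  let ?J = "{j \<in> {1..<Suc r}. R (f 0) (f j)}"
  let ?P = "{(i, j). 1 \<le> i \<and> i < j \<and> j < Suc L \<and> R (f i) (f j)}"
  have fin: "finite ?P"
    by (rule finite_subset[of _ "{..L} \<times> {..L}"]) auto
  have "{(i, j) \<in> head_edges L r. R (f i) (f j)} = Pair 0 ` ?J \<union> ?P"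
    using assms by (auto simp: head_edges_def Suc_le_eq image_iff)
  moreover have "Pair 0 ` ?J \<inter> ?P = {}" by auto
  ultimately have "card {(i, j) \<in> head_edges L r. R (f i) (f j)} = card ?J + card ?P"
    using fin by (simp add: card_Un_disjoint card_image inj_on_def)
  moreover have "length (filter (R (f 0)) (take r (map f [1..<Suc L]))) = card ?J"
    using assms by (simp add: take_map filter_map o_def take_upt del: upt_Suc flip: distinct_card)
  ultimately show ?thesis by (simp add: head_asc_def asc_pairs_map_upt del: upt_Suc)
qed

lemma head_maj_map:
  assumes "r \<le> L"
  shows "head_maj R r (f 0) (map f [1..<Suc L])
       = (\<Sum>t<L. if R (f t) (f (Suc t)) then if t = 0 then r else L - t else 0)"
proof (cases L)
  case 0
  then show ?thesis using assms by (simp add: head_maj_def)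
next
  case (Suc L')
  have "hd (map f [1..<Suc L]) = f 1"
    using Suc by (simp add: upt_conv_Cons del: upt_Suc)
  moreover have "(\<Sum>t<L. if R (f t) (f (Suc t)) then if t = 0 then r else L - t else 0)
      = (if R (f 0) (f 1) then r else 0) + (\<Sum>i\<in>{1..<L}. if R (f i) (f (Suc i)) then L - i else 0)"
    using Suc by (simp add: lessThan_atLeast0 sum.atLeast_Suc_lessThan cong: if_cong)
  ultimately show ?thesis
    by (simp add: head_maj_def asc_maj_map_upt del: upt_Suc)
qed

text \<open>
  Here \<open>L1\<close>, \<open>P\<close> and \<open>L2\<close> are the numbers of vertices minus one of
  the three pieces, so that positions and sizes are plain sums: the left head is \<open>1, ..., Suc L1\<close>, the
  path is \<open>Suc L1, ..., Suc L1 + P\<close>, and the right head comprises the following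
  \<open>L2\<close> vertices and the end of the path.
\<close>

abbreviation lollipop :: "nat \<Rightarrow> nat \<Rightarrow> nat \<Rightarrow> nat \<Rightarrow> nat \<Rightarrow> graph" where
  "lollipop L1 k1 P L2 k2 \<equiv> melting_lollipop (Suc L1) k1 (int P - 1) (Suc L2) k2"

lemma edges_melting_complete:
  assumes "k \<le> L"
  shows "edges (melting_complete_graph (Suc L) k) = (\<lambda>(i, j). (Suc i, Suc j)) ` head_edges L (L - k)"
proof -
  have "(i, j) \<in> edges (melting_complete_graph (Suc L) k)
      \<longleftrightarrow> (i, j) \<in> (\<lambda>(i, j). (Suc i, Suc j)) ` head_edges L (L - k)" for i j
    using assms
    by (cases i; cases j) (auto simp: melting_complete_graph_def complete_graph_def head_edges_def image_iff)
  then show ?thesis by auto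
qed

lemma edges_concat:
  "edges (concat_graph G H) = edges G \<union> (\<lambda>(i, j). (i + nverts G - 1, j + nverts G - 1)) ` edges H"
  by (auto simp: concat_graph_def image_iff)

lemma edges_reverse:
  "edges (reverse_graph G) = (\<lambda>(i, j). (nverts G + 1 - j, nverts G + 1 - i)) ` edges G"
  by (auto simp: reverse_graph_def image_iff) 

lemma edges_path: "edges (path_graph (Suc P)) = (\<lambda>i. (Suc i, Suc (Suc i))) ` {..<P}"
proof -
  have "(i, j) \<in> edges (path_graph (Suc P)) \<longleftrightarrow> (i, j) \<in> (\<lambda>i. (Suc i, Suc (Suc i))) ` {..<P}" for i j
    by (cases i) (auto simp: path_graph_def image_iff)
  then show ?thesis by auto
qed

lemma nverts_lollipop: "nverts (lollipop L1 k1 P L2 k2) = Suc (L1 + P + L2)"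
  by (simp add: melting_lollipop_def concat_graph_def reverse_graph_def path_graph_def
      melting_complete_graph_def nat_add_distrib)

lemma edges_lollipop:
  assumes "k1 \<le> L1" "k2 \<le> L2"
  shows "edges (lollipop L1 k1 P L2 k2) =
     (\<lambda>(i, j). (Suc L1 - j, Suc L1 - i)) ` head_edges L1 (L1 - k1)
     \<union> (\<lambda>i. (i, Suc i)) ` {Suc L1..<Suc L1 + P}
     \<union> (\<lambda>(i, j). (Suc L1 + P + i, Suc L1 + P + j)) ` head_edges L2 (L2 - k2)"
proof -
  have n: "nat (int P - 1 + 2) = Suc P" by simp
  have nv: "nverts (melting_complete_graph m k) = m" "nverts (reverse_graph G) = nverts G"
    "nverts (path_graph m) = m" "nverts (concat_graph G H) = nverts G + nverts H - 1" for m k G H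
    by (simp_all add: melting_complete_graph_def reverse_graph_def path_graph_def concat_graph_def)
  have "{Suc L1..<Suc L1 + P} = (\<lambda>i. i + Suc L1) ` {..<P}"
    using image_add_atLeastLessThan'[of "Suc L1" 0 P] by (simp add: lessThan_atLeast0 add.commute)
  then have path: "(\<lambda>i. (i, Suc i)) ` {Suc L1..<Suc L1 + P} = (\<lambda>i. (i + Suc L1, Suc (i + Suc L1))) ` {..<P}"
    by (simp only: image_image)
  show ?thesis
    unfolding melting_lollipop_def n edges_concat edges_reverse edges_path path nv
      edges_melting_complete[OF assms(1)] edges_melting_complete[OF assms(2)]
    by (simp add: image_image case_prod_beta add.commute add.left_commute)
qed

lemma asc_lollipop:
  fixes \<kappa> :: "nat \<Rightarrow> nat"
  assumes "k1 \<le> L1" "k2 \<le> L2"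
  shows "asc (lollipop L1 k1 P L2 k2) \<kappa> =
      card {(i, j) \<in> head_edges L1 (L1 - k1). \<kappa> (Suc L1 - j) < \<kappa> (Suc L1 - i)}
    + card {i \<in> {Suc L1..<Suc L1 + P}. \<kappa> i < \<kappa> (Suc i)}
    + card {(i, j) \<in> head_edges L2 (L2 - k2). \<kappa> (Suc L1 + P + i) < \<kappa> (Suc L1 + P + j)}"
proof -
  let ?A = "{(i, j) \<in> head_edges L1 (L1 - k1). \<kappa> (Suc L1 - j) < \<kappa> (Suc L1 - i)}"
  let ?B = "{i \<in> {Suc L1..<Suc L1 + P}. \<kappa> i < \<kappa> (Suc i)}"
  let ?C = "{(i, j) \<in> head_edges L2 (L2 - k2). \<kappa> (Suc L1 + P + i) < \<kappa> (Suc L1 + P + j)}"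
  let ?f = "\<lambda>(i, j). (Suc L1 - j, Suc L1 - i)"
  let ?g = "\<lambda>i. (i, Suc i)"
  let ?h = "\<lambda>(i, j). (Suc L1 + P + i, Suc L1 + P + j)"
  have fin: "finite ?A" "finite ?C"
    by (rule finite_subset[of _ "{..L1} \<times> {..L1}"], auto simp: head_edges_def)
       (rule finite_subset[of _ "{..L2} \<times> {..L2}"], auto simp: head_edges_def)
  have E: "{(i, j) \<in> edges (lollipop L1 k1 P L2 k2). i < j \<and> \<kappa> i < \<kappa> j} = ?f ` ?A \<union> ?g ` ?B \<union> ?h ` ?C"
    unfolding edges_lollipop[OF assms]
    by (auto simp: head_edges_def image_iff) 
  have "?f ` ?A \<inter> ?g ` ?B = {}" "(?f ` ?A \<union> ?g ` ?B) \<inter> ?h ` ?C = {}"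
    by (auto simp: head_edges_def)
  then have "asc (lollipop L1 k1 P L2 k2) \<kappa> = card (?f ` ?A) + card (?g ` ?B) + card (?h ` ?C)"
    unfolding asc_def E using fin by (subst card_Un_disjoint; simp)+
  moreover have "card (?f ` ?A) = card ?A"
    by (rule card_image) (auto simp: inj_on_def head_edges_def)
  moreover have "card (?g ` ?B) = card ?B" "card (?h ` ?C) = card ?C"
    by (rule card_image, auto simp: inj_on_def)+
  ultimately show ?thesis by simp
qed

text \<open>
  The later neighbours of \<open>i\<close> form an interval that starts at \<open>Suc i\<close>, so the
  maximum that defines the entry is their number.
\<close>

lemma area_seq_lollipop:
  assumes "k1 \<le> L1" "k2 \<le> L2" "Suc L1 \<le> i" "i < Suc (L1 + P + L2)"
  shows "entry (area_seq (lollipop L1 k1 P L2 k2)) i =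
    (if i < Suc L1 + P then 1 else if i = Suc L1 + P then L2 - k2 else Suc (L1 + P + L2) - i)"
    (is "_ = ?t")
proof -
  let ?E = "edges (lollipop L1 k1 P L2 k2)"
  have e: "(i, j) \<in> ?E \<longleftrightarrow> i < j \<and> j \<le> i + ?t" for j
  proof (cases "i < Suc L1 + P")
    case True
    then show ?thesis using assms(3)
      unfolding edges_lollipop[OF assms(1,2)] by (auto simp: head_edges_def)
  next
    case False
    then obtain i' where i': "i = Suc L1 + P + i'" using le_Suc_ex not_less by blast
    have "(i, j) \<in> ?E \<longleftrightarrow> (i, j) \<in> (\<lambda>(i, j). (Suc L1 + P + i, Suc L1 + P + j)) ` head_edges L2 (L2 - k2)"
      using False assms(3) unfolding edges_lollipop[OF assms(1,2)] by (auto simp: head_edges_def)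
    also have "\<dots> \<longleftrightarrow> i < j \<and> (i', j - (Suc L1 + P)) \<in> head_edges L2 (L2 - k2)"
      unfolding i' by (force simp: head_edges_def)
    also have "\<dots> \<longleftrightarrow> i < j \<and> j \<le> i + ?t"
      using i' assms by (auto simp: head_edges_def)
    finally show ?thesis .
  qed
  have "{0} \<union> {j - i | j. (i, j) \<in> ?E} = {0..?t}"
  proof -
    have "d \<in> {0} \<union> {j - i | j. i < j \<and> j \<le> i + t} \<longleftrightarrow> d \<in> {0..t}" for d t
      by (auto intro: exI[of _ "i + d"])
    then show ?thesis unfolding e by blast
  qed
  moreover have "Max {0..?t} = ?t" by (rule Max_eqI) auto
  ultimately show ?thesis using assms by (subst entry_area_seq) (simp_all only: nverts_lollipop)
qed

text \<open>
  In the left head, an ascent at \<open>i\<close> becomes an ascent at \<open>t = L1 - i\<close> when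
  positions and colors are reversed, and the modified entry at \<open>i\<close> is just the weight that
  \<open>head_maj\<close> gives to \<open>t\<close>. After the left head, the entries of the area sequence
  are already 1 on the path and the weights of \<open>head_maj\<close> on the right head.
\<close>

lemma seq_sum_lollipop:
  fixes \<kappa> :: "nat \<Rightarrow> nat"
  assumes "k1 \<le> L1" "k2 \<le> L2"
  shows "seq_sum (modified_seq (Suc L1) k1 (area_seq (lollipop L1 k1 P L2 k2)))
      {i \<in> {1..<Suc (L1 + P + L2)}. \<kappa> i < \<kappa> (i + 1)} =
      (\<Sum>t<L1. if \<kappa> (Suc L1 - Suc t) < \<kappa> (Suc L1 - t) then if t = 0 then L1 - k1 else L1 - t else 0)
    + card {i \<in> {Suc L1..<Suc L1 + P}. \<kappa> i < \<kappa> (Suc i)}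
    + (\<Sum>t<L2. if \<kappa> (Suc L1 + P + t) < \<kappa> (Suc L1 + P + Suc t) then if t = 0 then L2 - k2 else L2 - t else 0)"
proof -
  let ?a = "area_seq (lollipop L1 k1 P L2 k2)"
  let ?b = "modified_seq (Suc L1) k1 ?a"
  let ?N = "Suc (L1 + P + L2)"
  let ?s = "\<lambda>i. if \<kappa> i < \<kappa> (Suc i) then entry ?b i else 0"
  have b: "entry ?b i = (if i < L1 then i else if i = L1 then L1 - k1 else entry ?a i)"
    if "1 \<le> i" "i < ?N" for i
  proof -
    have "[1..<?N] ! (i - 1) = i" using that by (subst nth_upt) auto
    then show ?thesis
      unfolding entry_def[of ?b] unfolding modified_seq_def
      using that by (simp add: nverts_lollipop del: upt_Suc)
  qed
  have "seq_sum ?b {i \<in> {1..<?N}. \<kappa> i < \<kappa> (i + 1)} = sum ?s {1..<?N}"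
    unfolding seq_sum_def Suc_eq_plus1[symmetric] by (rule sum.inter_filter) simp
  also have "\<dots> = sum ?s {1..<Suc L1} + sum ?s {Suc L1..<Suc L1 + P} + sum ?s {Suc L1 + P..<?N}"
    by (subst sum.atLeastLessThan_concat; simp del: sum.op_ivl_Suc)+
  also have "sum ?s {1..<Suc L1} = (\<Sum>t<L1. if \<kappa> (Suc L1 - Suc t) < \<kappa> (Suc L1 - t)
       then if t = 0 then L1 - k1 else L1 - t else 0)"
    by (rule sum.reindex_bij_witness[of _ "\<lambda>t. L1 - t" "\<lambda>i. L1 - i"]) (auto simp: b Suc_diff_le)
  also have "sum ?s {Suc L1..<Suc L1 + P} = (\<Sum>i\<in>{Suc L1..<Suc L1 + P}. if \<kappa> i < \<kappa> (Suc i) then 1 else 0)"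
    by (intro sum.cong refl) (simp add: b area_seq_lollipop[OF assms])
  also have "\<dots> = card {i \<in> {Suc L1..<Suc L1 + P}. \<kappa> i < \<kappa> (Suc i)}"
    by (subst sum.inter_filter[symmetric]) simp_all
  also have "sum ?s {Suc L1 + P..<?N} = (\<Sum>t<L2. if \<kappa> (Suc L1 + P + t) < \<kappa> (Suc L1 + P + Suc t)
       then if t = 0 then L2 - k2 else L2 - t else 0)"
    by (rule sum.reindex_bij_witness[of _ "\<lambda>t. Suc L1 + P + t" "\<lambda>i. i - (Suc L1 + P)"])
       (auto simp: b area_seq_lollipop[OF assms])
  finally show ?thesis .
qed

section \<open>Colorings as words\<close>

definition word_coloring :: "nat list \<Rightarrow> nat \<Rightarrow> nat" where
  "word_coloring w = (\<lambda>i\<in>{1..length w}. w ! (i - 1))"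

lemma finite_words: "finite X \<Longrightarrow> finite (words X L)"
  by (simp add: words_def finite_lists_length_eq)

lemma image_mset_mset_set_upt:
  "image_mset \<kappa> (mset_set {1..n}) = mset (map \<kappa> [1..<Suc n])"
proof -
  have "mset_set {1..n} = mset [1..<Suc n]"
    by (metis atLeastLessThanSuc_atLeastAtMost mset_upt)
  then show ?thesis by (simp only: mset_map)
qed

lemma map_word_coloring: "map (word_coloring w) [1..<Suc (length w)] = w"
  by (rule nth_equalityI) (auto simp: word_coloring_def simp del: upt_Suc)

text \<open>
  Only the colors that occur in the monomial \<open>M\<close> matter, which makes the alphabet finite. If
  0 occurs in \<open>M\<close>, no word on the positive letters has content \<open>M\<close>, just as no
  coloring does.
\<close>

lemma sum_colorings:
  "(\<Sum>\<kappa>\<in>{\<kappa> \<in> colorings n. image_mset \<kappa> (mset_set {1..n}) = M}. g \<kappa>)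
   = (\<Sum>w\<in>words (set_mset M \<inter> {1..}) n. if mset w = M then g (word_coloring w) else 0)"
proof -
  let ?X = "set_mset M \<inter> {1..}"
  have "(\<Sum>\<kappa>\<in>{\<kappa> \<in> colorings n. image_mset \<kappa> (mset_set {1..n}) = M}. g \<kappa>)
      = (\<Sum>w\<in>{w \<in> words ?X n. mset w = M}. g (word_coloring w))"
  proof (rule sum.reindex_bij_witness[of _ word_coloring "\<lambda>\<kappa>. map \<kappa> [1..<Suc n]"])
    fix \<kappa> assume "\<kappa> \<in> {\<kappa> \<in> colorings n. image_mset \<kappa> (mset_set {1..n}) = M}"
    then have \<kappa>: "\<kappa> \<in> {1..n} \<rightarrow>\<^sub>E {1..}" and M: "mset (map \<kappa> [1..<Suc n]) = M"
      unfolding image_mset_mset_set_upt colorings_def by auto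
    have pos: "1 \<le> \<kappa> i" if "1 \<le> i" "i < Suc n" for i
      using \<kappa> that PiE_mem[OF \<kappa>, of i] by auto
    have "set (map \<kappa> [1..<Suc n]) \<subseteq> ?X"
      using pos M[symmetric] by (auto simp del: upt_Suc)
    then show "map \<kappa> [1..<Suc n] \<in> {w \<in> words ?X n. mset w = M}"
      using M by (simp add: words_def del: upt_Suc)
    show *: "word_coloring (map \<kappa> [1..<Suc n]) = \<kappa>"
    proof
      fix i show "word_coloring (map \<kappa> [1..<Suc n]) i = \<kappa> i"
        using PiE_arb[OF \<kappa>, of i] by (auto simp: word_coloring_def simp del: upt_Suc)
    qed
    show "g (word_coloring (map \<kappa> [1..<Suc n])) = g \<kappa>" by (simp only: *)
  next
    fix w assume w: "w \<in> {w \<in> words ?X n. mset w = M}"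
    then have n: "length w = n" and X: "set w \<subseteq> ?X" and M: "mset w = M" by (auto simp: words_def)
    show m: "map (word_coloring w) [1..<Suc n] = w" using map_word_coloring[of w] n by simp
    have "w ! (i - 1) \<in> ?X" if "i \<in> {1..n}" for i
    proof -
      have "i - 1 < length w" using n that by auto
      then show ?thesis using X nth_mem by blast
    qed
    then have "word_coloring w \<in> colorings n"
      unfolding colorings_def word_coloring_def n by (simp add: restrict_PiE_iff)
    moreover have "image_mset (word_coloring w) (mset_set {1..n}) = M"
      by (simp only: image_mset_mset_set_upt m M)
    ultimately show "word_coloring w \<in> {\<kappa> \<in> colorings n. image_mset \<kappa> (mset_set {1..n}) = M}"
      by blast
  qed
  also have "\<dots> = (\<Sum>w\<in>words ?X n. if mset w = M then g (word_coloring w) else 0)"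
    by (rule sum.inter_filter) (simp add: finite_words)
  finally show ?thesis .
qed

text \<open>
  The left head is read from its joining vertex backwards, which reverses \<open>u\<close> and turns
  ascents into descents.
\<close>

lemma word_coloring_stats:
  fixes u p v :: "nat list" and d :: nat
  assumes k: "k1 \<le> L1" "k2 \<le> L2"
    and len: "length u = L1" "length p = P" "length v = L2"
  defines "w \<equiv> u @ p @ d # v"
    and "mid \<equiv> card {i \<in> {..<length p}. (p @ [d]) ! i < (p @ [d]) ! Suc i}"
  shows "asc (lollipop L1 k1 P L2 k2) (word_coloring w) =
           head_asc (>) (L1 - k1) (hd (p @ [d])) (rev u) + mid + head_asc (<) (L2 - k2) d v" (is ?asc)
    and "seq_sum (modified_seq (Suc L1) k1 (area_seq (lollipop L1 k1 P L2 k2)))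
           {i \<in> {1..<Suc (L1 + P + L2)}. word_coloring w i < word_coloring w (i + 1)} =
           head_maj (>) (L1 - k1) (hd (p @ [d])) (rev u) + mid + head_maj (<) (L2 - k2) d v" (is ?maj)
proof -
  define \<kappa> where "\<kappa> = word_coloring w"
  define f1 where "f1 = (\<lambda>t. \<kappa> (Suc L1 - t))"
  define f2 where "f2 = (\<lambda>t. \<kappa> (Suc L1 + P + t))"
  have \<kappa>: "\<kappa> (Suc i) = w ! i" if "i < Suc (L1 + P + L2)" for i
    using that len by (simp add: \<kappa>_def word_coloring_def w_def)
  have u: "rev u = map f1 [1..<Suc L1]"
    by (rule nth_equalityI) (simp_all add: len f1_def Suc_diff_Suc[symmetric] \<kappa> rev_nth w_def nth_append del: upt_Suc)
  have c: "hd (p @ [d]) = f1 0"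
    using len by (cases p) (simp_all add: f1_def \<kappa> w_def nth_append)
  have v: "v = map f2 [1..<Suc L2]"
    by (rule nth_equalityI) (simp_all add: len f2_def \<kappa> w_def nth_append del: upt_Suc)
  have d: "d = f2 0" using len by (simp add: f2_def \<kappa> w_def nth_append)
  have mid: "mid = card {i \<in> {Suc L1..<Suc L1 + P}. \<kappa> i < \<kappa> (Suc i)}"
  proof -
    have pd: "(p @ [d]) ! i = \<kappa> (Suc L1 + i)" if "i \<le> P" for i
      using that len by (simp add: \<kappa> w_def nth_append)
    have "{i \<in> {Suc L1..<Suc L1 + P}. \<kappa> i < \<kappa> (Suc i)}
        = (+) (Suc L1) ` {i \<in> {..<P}. (p @ [d]) ! i < (p @ [d]) ! Suc i}" (is "?B = _ ` ?B'")
    proof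
      show "?B \<subseteq> (+) (Suc L1) ` ?B'"
      proof
        fix i assume "i \<in> ?B"
        then have "i = Suc L1 + (i - Suc L1) \<and> i - Suc L1 \<in> ?B'"
          by (auto simp: pd)
        then show "i \<in> (+) (Suc L1) ` ?B'" by blast
      qed
    qed (auto simp: pd)
    moreover have "card ((+) (Suc L1) ` ?B') = card ?B'" by (rule card_image) simp
    ultimately show ?thesis by (simp only: mid_def len)
  qed
  note asc = head_asc_map[of "L1 - k1" L1 "(>)" f1, folded u c] head_asc_map[of "L2 - k2" L2 "(<)" f2, folded v d]
  note maj = head_maj_map[of "L1 - k1" L1 "(>)" f1, folded u c] head_maj_map[of "L2 - k2" L2 "(<)" f2, folded v d]
  show ?asc unfolding \<kappa>_def[symmetric] asc_lollipop[OF k] mid using asc by (simp add: f1_def f2_def)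
  show ?maj unfolding \<kappa>_def[symmetric] seq_sum_lollipop[OF k] mid using maj by (simp add: f1_def f2_def)
qed

theorem theorem4p3:
  fixes n :: int and m1 k1 m2 k2 N :: nat and a b :: "nat list"
  assumes "n \<ge> -1"
    and "m1 \<ge> 1" and "k1 \<le> m1 - 1"
    and "m2 \<ge> 1" and "k2 \<le> m2 - 1"
    and "N = nat (int m1 + n + int m2)"
    and "a = area_seq (melting_lollipop m1 k1 n m2 k2)"
    and "b = modified_seq m1 k1 a"
  shows "LLT a =
    (\<Sum>\<alpha>\<in>compositions N. scale_series (monom 1 (seq_sum b (comp_set \<alpha>))) (ribbon \<alpha>))"
proof
  fix M :: "nat multiset"
  define L1 L2 P where "L1 = m1 - 1" and "L2 = m2 - 1" and "P = nat (n + 1)"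
  have eqs: "m1 = Suc L1" "m2 = Suc L2" "n = int P - 1"
    using assms(1,2,4) by (simp_all add: L1_def L2_def P_def)
  have k: "k1 \<le> L1" "k2 \<le> L2" using assms(3,5) eqs by simp_all
  have N: "N = Suc (L1 + P + L2)" using assms(6) eqs by simp
  have N': "N = L1 + (P + Suc L2)" by (simp add: N)
  let ?G = "lollipop L1 k1 P L2 k2"
  let ?X = "set_mset M \<inter> {1..}"
  let ?C = "{\<kappa> \<in> colorings N. image_mset \<kappa> (mset_set {1..N}) = M}"
  let ?maj = "\<lambda>\<kappa>. seq_sum b {i \<in> {1..<N}. \<kappa> i < \<kappa> (i + 1)}"
  have a: "a = area_seq ?G" and b: "b = modified_seq (Suc L1) k1 (area_seq ?G)"
    using assms(7,8) eqs by simp_all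
  define q :: "int poly" where "q = monom 1 1"
  have q: "monom 1 k = q ^ k" for k by (simp add: q_def monom_power)
  \<comment> \<open>The indicator of the content that belongs to the coefficient in question.\<close>
  define H :: "nat multiset \<Rightarrow> int poly" where "H = (\<lambda>A. if A = M then 1 else 0)"
  define mid where "mid = (\<lambda>p (d::nat). card {i \<in> {..<length p}. (p @ [d]) ! i < (p @ [d]) ! Suc i})"
  have split: "(\<Sum>\<kappa>\<in>?C. q ^ s \<kappa>) = (\<Sum>u\<in>words ?X L1. \<Sum>p\<in>words ?X P. \<Sum>d\<in>?X. \<Sum>v\<in>words ?X L2.
      H (mset (u @ p @ d # v)) * q ^ s (word_coloring (u @ p @ d # v)))" for s
    unfolding sum_colorings unfolding N' sum_words_append sum_words_Suc
    by (intro sum.cong refl) (simp add: H_def)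
  have "LLT a M = (\<Sum>\<kappa>\<in>?C. q ^ asc ?G \<kappa>)"
  proof -
    have "unit_interval_graph ?G" by (rule unit_interval_melting_lollipop) auto
    then have "LLT a M = LLT_graph ?G M" by (simp add: a LLT_area_seq)
    also have "\<dots> = (\<Sum>\<kappa>\<in>?C. q ^ asc ?G \<kappa>)"
      unfolding LLT_graph_def nverts_lollipop N[symmetric] q by (rule formal_sum_colorings) simp
    finally show ?thesis .
  qed
  also have "\<dots> = (\<Sum>u\<in>words ?X L1. \<Sum>p\<in>words ?X P. \<Sum>d\<in>?X. \<Sum>v\<in>words ?X L2.
      H (mset (u @ p @ d # v)) * q ^
        (head_asc (>) (L1 - k1) (hd (p @ [d])) (rev u) + mid p d + head_asc (<) (L2 - k2) d v))"
    unfolding split mid_def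
    by (intro sum.cong refl) (simp only: words_def mem_Collect_eq word_coloring_stats[OF k])
  also have "\<dots> = (\<Sum>u\<in>words ?X L1. \<Sum>p\<in>words ?X P. \<Sum>d\<in>?X. \<Sum>v\<in>words ?X L2.
      H (mset (u @ p @ d # v)) * q ^
        (head_maj (>) (L1 - k1) (hd (p @ [d])) (rev u) + mid p d + head_maj (<) (L2 - k2) d v))"
    by (rule sum_words_two_heads[symmetric]) auto
  also have "\<dots> = (\<Sum>\<kappa>\<in>?C. q ^ ?maj \<kappa>)"
    unfolding split mid_def unfolding b N
    by (intro sum.cong refl) (simp only: words_def mem_Collect_eq word_coloring_stats[OF k])
  also have "\<dots> = (\<Sum>\<alpha>\<in>compositions N. scale_series (monom 1 (seq_sum b (comp_set \<alpha>))) (ribbon \<alpha>)) M"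
    unfolding q
    by (rule sum_scaled_ribbons[symmetric, where c = "\<lambda>S. q ^ seq_sum b S"]) (simp add: N)
  finally show "LLT a M = \<dots>" .
qed

end
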